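(* Let $\mathbf{x}_1,\dots,\mathbf{x}_r\in\mathcal{H}$, where $\mathcal{H}$ is the upper sheet of the hyperboloid, and let $$\mathcal{C}=\mathcal{C}_{\mathcal{H}}(\mathbf{x}_1,\dots,\mathbf{x}_r)=\frac{\sum_{j=1}^r\mathbf{x}_j}{\left\|\sum_{j=1}^r\mathbf{x}_j\right\|}$$ be their center of mass. The center of mass is $\mathrm{SL}_2(\mathbb{R})$-invariant, i.e. $\mathcal{C}_{\mathcal{H}}(\mathbf{x}_1\cdot M,\dots,\mathbf{x}_r\cdot M)=\mathcal{C}_{\mathcal{H}}(\mathbf{x}_1,\dots,\mathbf{x}_r)\cdot M$ for every $M\in\mathrm{SL}_2(\mathbb{R})$. Moreover, it is the unique point $\mathbf{x}\in\mathcal{H}$ that minimizes $$\sum_{j=1}^r\cosh\left(d_H(\mathbf{x},\mathbf{x}_j)\right).$$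
   Context: On $\mathbb{R}^3$ let $M(\mathbf{x},\mathbf{y})=-x_1y_1-x_2y_2+x_3y_3$ be the Minkowski pairing and $\|\mathbf{x}\|^2=M(\mathbf{x},\mathbf{x})$ (with $\|\mathbf{x}\|$ the positive square root when this is positive). Let $\mathcal{H}=\{\mathbf{x}\in\mathbb{R}^3:\|\mathbf{x}\|=1,\ x_3>0\}$, with metric $ds^2=dx_1^2+dx_2^2-dx_3^2$; this is the hyperboloid model of the hyperbolic plane, and its hyperbolic distance $d_H$ satisfies $\cosh d_H(\mathbf{x},\mathbf{y})=M(\mathbf{x},\mathbf{y})$ for $\mathbf{x},\mathbf{y}\in\mathcal{H}$. The group $\mathrm{SL}_2(\mathbb{R})$ acts on the right on the upper half-plane $\mathcal{H}_2$ by $z\cdot M:=M^{-1}z=\frac{az+b}{cz+d}$, where $M^{-1}=\begin{pmatrix}a&b\\c&d\end{pmatrix}$. It acts on $\mathcal{H}$ by isometries via transport along the isometry $\mathcal{H}_2\to\mathcal{H}$, $$u+\mathbf{i}v\mapsto\left(\frac{1-u^2-v^2}{2v},\ \frac{u}{v},\ \frac{1+u^2+v^2}{2v}\right).$$ *)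

theory Defs
  imports "HOL-Analysis.Analysis"
begin

definition mink :: "real^3 \<Rightarrow> real^3 \<Rightarrow> real" where
  "mink x y = - (x$1 * y$1) - x$2 * y$2 + x$3 * y$3"

text \<open>\<open>sqrt\<close> is an odd function on all reals; this is the Minkowski norm only where
  \<open>mink x x > 0\<close>.\<close>
definition mink_norm :: "real^3 \<Rightarrow> real" where
  "mink_norm x = sqrt (mink x x)"

definition hyperboloid :: "(real^3) set" where
  "hyperboloid = {x. mink x x = 1 \<and> x$3 > 0}"

text \<open>The metric $ds^2 = dx_1^2 + dx_2^2 - dx_3^2$ is \<open>- mink\<close>, which is positive definite on the
  tangent planes of the hyperboloid.\<close>
definition hyp_length :: "(real \<Rightarrow> real^3) \<Rightarrow> real" where
  "hyp_length \<gamma> =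
     integral {0..1}
       (\<lambda>t. sqrt (- mink (vector_derivative \<gamma> (at t)) (vector_derivative \<gamma> (at t))))"

text \<open>The Riemannian distance. The curves are required to be \<open>C\<^sup>1\<close> on the closed interval:
  under \<^const>\<open>valid_path\<close> the derivative may be unbounded near finitely many points, the
  speed need not be integrable, and the integral would then take its default value \<open>0\<close>.\<close>
definition hyp_dist :: "real^3 \<Rightarrow> real^3 \<Rightarrow> real" where
  "hyp_dist x y =
     Inf {hyp_length \<gamma> | \<gamma>. \<gamma> C1_differentiable_on {0..1} \<and>
            path_image \<gamma> \<subseteq> hyperboloid \<and> pathstart \<gamma> = x \<and> pathfinish \<gamma> = y}"

definition upper_half_plane :: "complex set" where
  "upper_half_plane = {z. Im z > 0}"

definition to_hyperboloid :: "complex \<Rightarrow> real^3" where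
  "to_hyperboloid z =
     (let u = Re z; v = Im z in
      vector [(1 - u\<^sup>2 - v\<^sup>2) / (2 * v), u / v, (1 + u\<^sup>2 + v\<^sup>2) / (2 * v)])"

definition SL2R :: "(real^2^2) set" where
  "SL2R = {A. det A = 1}"

text \<open>Right actions: \<open>A\<close> acts through the fractional linear transformation of its inverse.\<close>
definition uhp_act :: "complex \<Rightarrow> real^2^2 \<Rightarrow> complex" where
  "uhp_act z A =
     (let B = matrix_inv A in
      moebius (complex_of_real (B$1$1)) (complex_of_real (B$1$2))
              (complex_of_real (B$2$1)) (complex_of_real (B$2$2)) z)"

definition hyp_act :: "real^3 \<Rightarrow> real^2^2 \<Rightarrow> real^3" where
  "hyp_act x A = to_hyperboloid (uhp_act (inv_into upper_half_plane to_hyperboloid x) A)"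

definition center_of_mass :: "nat \<Rightarrow> (nat \<Rightarrow> real^3) \<Rightarrow> real^3" where
  "center_of_mass r x = (\<Sum>j=1..r. x j) /\<^sub>R mink_norm (\<Sum>j=1..r. x j)"

end

theory Submission
  imports Defs
begin

text \<open>
  Let \<open>S\<close> be the sum of the points and \<open>c = S / \<parallel>S\<parallel>\<close> the center of mass.

  Minimality rests on \<open>cosh (hyp_dist p q) = mink p q\<close>. Granting this, the objective function is
  linear: at \<open>p\<close> it equals \<open>mink p S = \<parallel>S\<parallel> * mink p c\<close>. By the reversed Cauchy-Schwarz
  inequality two points of the hyperboloid satisfy \<open>mink p c \<ge> 1\<close>, with equality only for
  \<open>p = c\<close>, so \<open>c\<close> is the only minimizer.

  The distance formula has to be derived for an infimum of lengths of curves. The upper bound is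
  the length of the explicit geodesic \<open>cosh (t d) p + sinh (t d) n\<close>. For the lower bound one looks
  for a function with gradient of norm at most one that grows along this geodesic at unit speed.
  The obvious candidate, the distance from \<open>p\<close>, is not differentiable at \<open>p\<close>, where every
  curve starts and to which it may return. The signed distance \<open>z \<mapsto> arsinh (- mink n z)\<close> to
  the geodesic through \<open>p\<close> orthogonal to \<open>n\<close> is smooth everywhere and agrees with the distance
  from \<open>p\<close> on the ray from \<open>p\<close> to \<open>q\<close>; its gradient bound is the Cauchy-Schwarz inequality in the tangent plane
  (\<open>tangent_cauchy_schwarz\<close>).

  Invariance holds because the action is the restriction of a linear map that preserves the
  Minkowski form. To see this, identify a vector \<open>p\<close> with the symmetric matrix with rows
  \<open>(p\<^sub>3 - p\<^sub>1, p\<^sub>2)\<close> and \<open>(p\<^sub>2, p\<^sub>3 + p\<^sub>1)\<close>, whose determinant is \<open>mink p p\<close>. The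
  point of the hyperboloid that belongs to \<open>z = u + i v\<close> becomes the matrix with rows
  \<open>(\<bar>z\<bar>\<^sup>2 / v, u / v)\<close> and \<open>(u / v, 1 / v)\<close>, and the fractional linear transformation of \<open>B\<close>
  becomes \<open>X \<mapsto> B X B\<^sup>T\<close>.
\<close>

section \<open>Minkowski geometry of the hyperboloid\<close>

lemma bounded_bilinear_mink: "bounded_bilinear mink"
  unfolding bilinear_conv_bounded_bilinear[symmetric] bilinear_def
  by (auto intro!: linearI simp: mink_def algebra_simps)

interpretation mink: bounded_bilinear mink
  by (rule bounded_bilinear_mink)

lemmas mink_expand = mink.add_left mink.add_right mink.diff_left mink.diff_right
  mink.minus_left mink.minus_right mink.scaleR_left mink.scaleR_right

lemma mink_commute: "mink x y = mink y x"
  by (simp add: mink_def)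

lemma tangent_spacelike:
  assumes "p \<in> hyperboloid" "mink p w = 0"
  shows "mink w w \<le> 0" and "mink w w = 0 \<Longrightarrow> w = 0"
proof -
  have p: "(p$3)\<^sup>2 = 1 + (p$1)\<^sup>2 + (p$2)\<^sup>2" and p3: "p$3 > 0"
    using assms(1) by (auto simp: hyperboloid_def mink_def power2_eq_square)
  have w: "w$3 * p$3 = p$1 * w$1 + p$2 * w$2"
    using assms(2) by (simp add: mink_def algebra_simps)
  have "(p$3)\<^sup>2 * - mink w w = (p$3)\<^sup>2 * ((w$1)\<^sup>2 + (w$2)\<^sup>2) - (w$3 * p$3)\<^sup>2"
    by (simp add: mink_def power2_eq_square algebra_simps)
  also have "\<dots> = (w$1)\<^sup>2 + (w$2)\<^sup>2 + (p$1 * w$2 - p$2 * w$1)\<^sup>2"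
    unfolding w p by (simp add: power2_eq_square algebra_simps)
  finally have key: "(p$3)\<^sup>2 * - mink w w = (w$1)\<^sup>2 + (w$2)\<^sup>2 + (p$1 * w$2 - p$2 * w$1)\<^sup>2" .
  have "0 \<le> (p$3)\<^sup>2 * - mink w w"
    unfolding key by simp
  then show "mink w w \<le> 0"
    using p3 by (simp add: mult_le_0_iff)
  assume "mink w w = 0"
  then have "(w$1)\<^sup>2 + (w$2)\<^sup>2 + (p$1 * w$2 - p$2 * w$1)\<^sup>2 = 0"
    using key by simp
  then have "w$1 = 0" "w$2 = 0"
    by (simp_all add: add_nonneg_eq_0_iff)
  with w p3 show "w = 0"
    by (simp add: vec_eq_iff forall_3)
qed

text \<open>The tangent plane at \<open>p\<close> is definite, so Cauchy-Schwarz holds there. It is applied to the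
  tangential part \<open>u\<close> of \<open>n\<close>, which is up to sign the gradient of \<open>mink n\<close> at \<open>p\<close>.\<close>

lemma tangent_cauchy_schwarz:
  assumes p: "p \<in> hyperboloid" and w: "mink p w = 0"
  shows "(mink n w)\<^sup>2 \<le> ((mink n p)\<^sup>2 - mink n n) * - mink w w"
proof -
  define u where "u = n - mink n p *\<^sub>R p"
  define a where "a = - mink w w"
  define b where "b = mink u w"
  have pp: "mink p p = 1"
    using p by (simp add: hyperboloid_def)
  have pu: "mink p u = 0"
    by (simp add: u_def mink_expand pp mink_commute)
  have b: "b = mink n w"
    by (simp add: b_def u_def mink_expand w)
  have uu: "mink u u = mink n n - (mink n p)\<^sup>2"
    by (simp add: u_def mink_expand pp mink_commute[of p n] power2_eq_square algebra_simps)
  \<comment> \<open>The tangent vector \<open>a *\<^sub>R u + b *\<^sub>R w\<close> is orthogonal to \<open>w\<close>: Gram-Schmidt without division.\<close>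
  have "mink (a *\<^sub>R u + b *\<^sub>R w) (a *\<^sub>R u + b *\<^sub>R w) = a * (a * mink u u + b\<^sup>2)"
    by (simp add: mink_expand mink_commute[of w u] flip: b_def)
      (simp add: a_def power2_eq_square algebra_simps)
  moreover have "mink p (a *\<^sub>R u + b *\<^sub>R w) = 0"
    by (simp add: mink_expand pu w)
  ultimately have le: "a * (a * mink u u + b\<^sup>2) \<le> 0"
    using tangent_spacelike(1)[OF p] by metis
  show ?thesis
  proof (cases "w = 0")
    case True
    then show ?thesis by (simp add: mink.zero_right)
  next
    case False
    then have "a > 0"
      using tangent_spacelike[OF p w] by (force simp: a_def)
    with le have "a * mink u u + b\<^sup>2 \<le> 0"
      by (simp add: mult_le_0_iff)
    then show ?thesis
      by (simp add: b uu a_def algebra_simps)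
  qed
qed

lemma mink_hyperboloid_pos:
  assumes "p \<in> hyperboloid" "q \<in> hyperboloid"
  shows "mink p q > 0"
proof -
  have p: "(p$3)\<^sup>2 = 1 + (p$1)\<^sup>2 + (p$2)\<^sup>2" and q: "(q$3)\<^sup>2 = 1 + (q$1)\<^sup>2 + (q$2)\<^sup>2"
    and pos: "p$3 > 0" "q$3 > 0"
    using assms by (auto simp: hyperboloid_def mink_def power2_eq_square)
  have "(p$3 * q$3)\<^sup>2 = (p$1 * q$1 + p$2 * q$2)\<^sup>2 + (p$1 * q$2 - p$2 * q$1)\<^sup>2
      + (1 + (p$1)\<^sup>2 + (p$2)\<^sup>2 + (q$1)\<^sup>2 + (q$2)\<^sup>2)"
    unfolding power_mult_distrib p q by (simp add: power2_eq_square algebra_simps)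
  moreover have "0 \<le> (p$1 * q$2 - p$2 * q$1)\<^sup>2"
    "0 < 1 + (p$1)\<^sup>2 + (p$2)\<^sup>2 + (q$1)\<^sup>2 + (q$2)\<^sup>2"
    by (simp_all add: add_pos_nonneg)
  ultimately have "(p$1 * q$1 + p$2 * q$2)\<^sup>2 < (p$3 * q$3)\<^sup>2"
    by linarith
  then have "p$1 * q$1 + p$2 * q$2 < p$3 * q$3"
    using pos by (intro power2_less_imp_less[of _ "p$3 * q$3"]) auto
  then show ?thesis
    by (simp add: mink_def)
qed

text \<open>The tangential part \<open>q - mink p q *\<^sub>R p\<close> of \<open>q\<close> at \<open>p\<close> has norm \<open>1 - (mink p q)\<^sup>2\<close>, which
  cannot be positive and vanishes only if \<open>q\<close> is a multiple of \<open>p\<close>.\<close>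

lemma mink_hyperboloid_ge_1:
  assumes p: "p \<in> hyperboloid" and q: "q \<in> hyperboloid"
  shows "mink p q \<ge> 1" and "mink p q = 1 \<Longrightarrow> p = q"
proof -
  define u where "u = q - mink p q *\<^sub>R p"
  have pp: "mink p p = 1" and qq: "mink q q = 1"
    using p q by (simp_all add: hyperboloid_def)
  have pu: "mink p u = 0"
    by (simp add: u_def mink_expand pp)
  have uu: "mink u u = 1 - (mink p q)\<^sup>2"
    by (simp add: u_def mink_expand pp qq mink_commute[of q p] power2_eq_square algebra_simps)
  have "1\<^sup>2 \<le> (mink p q)\<^sup>2"
    using tangent_spacelike(1)[OF p pu] unfolding uu by simp
  then show "mink p q \<ge> 1"
    using mink_hyperboloid_pos[OF p q] by (intro power2_le_imp_le[of 1]) auto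
  assume pq: "mink p q = 1"
  then have "mink u u = 0"
    by (simp add: uu)
  from tangent_spacelike(2)[OF p pu this] show "p = q"
    unfolding u_def pq by simp
qed

text \<open>The sheet that contains a unit vector \<open>p\<close> can be read off from the pairing with any point
  \<open>q\<close> of the upper sheet, because \<open>- p\<close> would pair positively with \<open>q\<close> otherwise.\<close>

lemma hyperboloid_by_pairing:
  assumes pp: "mink p p = 1" and q: "q \<in> hyperboloid" and pq: "mink p q > 0"
  shows "p \<in> hyperboloid"
proof -
  have "(p$3)\<^sup>2 = 1 + ((p$1)\<^sup>2 + (p$2)\<^sup>2)"
    using pp by (simp add: mink_def power2_eq_square)
  also have "\<dots> > 0"
    by (intro add_pos_nonneg) auto
  finally have "p$3 \<noteq> 0"
    by simp
  moreover have "\<not> p$3 < 0"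
  proof
    assume "p$3 < 0"
    then have "- p \<in> hyperboloid"
      using pp by (simp add: hyperboloid_def mink.minus_left mink.minus_right)
    then have "mink (- p) q > 0"
      using q by (rule mink_hyperboloid_pos)
    then show False
      using pq unfolding mink.minus_left by linarith
  qed
  ultimately show ?thesis
    using pp by (simp add: hyperboloid_def)
qed

section \<open>The Riemannian distance\<close>

text \<open>Differentiating \<open>mink (\<gamma> s) (\<gamma> s) = 1\<close> gives the claim. Outside \<open>{0..1}\<close> the curve may leave
  the hyperboloid, so at the end points only the one-sided derivative of this identity is
  available.\<close>

lemma curve_velocity_tangent:
  assumes deriv: "\<forall>t\<in>{0..1}. (\<gamma> has_vector_derivative \<gamma>' t) (at t)"
    and img: "path_image \<gamma> \<subseteq> hyperboloid" and t: "t \<in> {0..1}"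
  shows "mink (\<gamma> t) (\<gamma>' t) = 0"
proof -
  have unit: "mink (\<gamma> s) (\<gamma> s) = 1" if "s \<in> {0..1}" for s
  proof -
    have "\<gamma> s \<in> hyperboloid"
      using img that by (auto simp: path_image_def)
    then show ?thesis by (simp add: hyperboloid_def)
  qed
  have "((\<lambda>s. mink (\<gamma> s) (\<gamma> s)) has_vector_derivative
      mink (\<gamma> t) (\<gamma>' t) + mink (\<gamma>' t) (\<gamma> t)) (at t within {0..1})"
    by (rule mink.has_vector_derivative; rule has_vector_derivative_at_within[OF bspec[OF deriv t]])
  moreover have "((\<lambda>s. mink (\<gamma> s) (\<gamma> s)) has_vector_derivative 0) (at t within {0..1})"
    by (rule has_vector_derivative_transform[OF t unit has_vector_derivative_const])
  ultimately have "mink (\<gamma> t) (\<gamma>' t) + mink (\<gamma>' t) (\<gamma> t) = 0"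
    using t by (intro vector_derivative_unique_within_closed_interval[of 0 1 t, OF zero_less_one])
      (simp_all only: cbox_interval)
  then show ?thesis
    by (simp add: mink_commute)
qed

text \<open>The function \<open>z \<mapsto> arsinh (- mink n z)\<close> has a gradient of norm at most one on the
  hyperboloid when \<open>n\<close> is a unit spacelike vector, so it cannot grow along a curve by more than the
  length of the curve.\<close>

lemma hyp_length_lower_bound:
  assumes C1: "\<gamma> C1_differentiable_on {0..1}" and img: "path_image \<gamma> \<subseteq> hyperboloid"
    and nn: "mink n n = -1"
  shows "arsinh (- mink n (pathfinish \<gamma>)) - arsinh (- mink n (pathstart \<gamma>)) \<le> hyp_length \<gamma>"
proof -
  obtain \<gamma>' where deriv: "\<forall>t\<in>{0..1}. (\<gamma> has_vector_derivative \<gamma>' t) (at t)"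
    and cont: "continuous_on {0..1} \<gamma>'"
    using C1 unfolding C1_differentiable_on_def by blast
  define g where "g t = - mink n (\<gamma> t)" for t
  define g' where "g' t = - mink n (\<gamma>' t)" for t
  have g: "((\<lambda>t. arsinh (g t)) has_vector_derivative (1 / sqrt ((g t)\<^sup>2 + 1)) * g' t)
      (at t within {0..1})" if "t \<in> {0..1}" for t
  proof -
    have "((\<lambda>t. mink n (\<gamma> t)) has_vector_derivative mink n (\<gamma>' t)) (at t within {0..1})"
      using mink.has_vector_derivative[OF has_vector_derivative_const[of n]
          has_vector_derivative_at_within[OF bspec[OF deriv that]]]
      by (simp add: mink.zero_left)
    then have "(g has_vector_derivative g' t) (at t within {0..1})"
      unfolding g_def g'_def by (rule has_vector_derivative_minus)
    then have "(g has_real_derivative g' t) (at t within {0..1})"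
      by (simp add: has_real_derivative_iff_has_vector_derivative)
    from DERIV_chain2[OF arsinh_real_has_field_derivative this] show ?thesis
      by (simp add: has_real_derivative_iff_has_vector_derivative)
  qed
  have "((\<lambda>t. (1 / sqrt ((g t)\<^sup>2 + 1)) * g' t) has_integral arsinh (g 1) - arsinh (g 0)) {0..1}"
    using g by (intro fundamental_theorem_of_calculus) auto
  moreover have "((\<lambda>t. sqrt (- mink (\<gamma>' t) (\<gamma>' t))) has_integral hyp_length \<gamma>) {0..1}"
  proof -
    have "continuous_on {0..1} (\<lambda>t. sqrt (- mink (\<gamma>' t) (\<gamma>' t)))"
      using cont by (intro continuous_intros mink.continuous_on)
    then have "((\<lambda>t. sqrt (- mink (\<gamma>' t) (\<gamma>' t))) has_integral
        integral {0..1} (\<lambda>t. sqrt (- mink (\<gamma>' t) (\<gamma>' t)))) {0..1}"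
      by (intro integrable_integral integrable_continuous_real)
    also have "integral {0..1} (\<lambda>t. sqrt (- mink (\<gamma>' t) (\<gamma>' t))) = hyp_length \<gamma>"
      unfolding hyp_length_def
      by (intro integral_cong) (simp add: vector_derivative_at[OF bspec[OF deriv]])
    finally show ?thesis .
  qed
  moreover have "(1 / sqrt ((g t)\<^sup>2 + 1)) * g' t \<le> sqrt (- mink (\<gamma>' t) (\<gamma>' t))"
    if t: "t \<in> {0..1}" for t
  proof -
    have "\<gamma> t \<in> hyperboloid"
      using img t by (auto simp: path_image_def)
    from tangent_cauchy_schwarz[OF this curve_velocity_tangent[OF deriv img t], of n]
    have "(g' t)\<^sup>2 \<le> ((g t)\<^sup>2 + 1) * - mink (\<gamma>' t) (\<gamma>' t)"
      by (simp add: g_def g'_def nn)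
    then have "g' t \<le> sqrt (((g t)\<^sup>2 + 1) * - mink (\<gamma>' t) (\<gamma>' t))"
      by (rule real_le_rsqrt)
    then have "g' t \<le> sqrt ((g t)\<^sup>2 + 1) * sqrt (- mink (\<gamma>' t) (\<gamma>' t))"
      by (simp only: real_sqrt_mult)
    moreover have "sqrt ((g t)\<^sup>2 + 1) > 0"
      by (simp add: add_nonneg_pos)
    ultimately show ?thesis
      by (simp add: divide_le_eq mult.commute)
  qed
  ultimately have "arsinh (g 1) - arsinh (g 0) \<le> hyp_length \<gamma>"
    by (rule has_integral_le)
  then show ?thesis
    by (simp add: g_def pathstart_def pathfinish_def)
qed

lemma hyp_length_nonneg:
  assumes C1: "\<gamma> C1_differentiable_on {0..1}" and img: "path_image \<gamma> \<subseteq> hyperboloid"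
  shows "0 \<le> hyp_length \<gamma>"
proof -
  obtain \<gamma>' where deriv: "\<forall>t\<in>{0..1}. (\<gamma> has_vector_derivative \<gamma>' t) (at t)"
    using C1 unfolding C1_differentiable_on_def by blast
  have "mink (\<gamma>' t) (\<gamma>' t) \<le> 0" if t: "t \<in> {0..1}" for t
  proof (rule tangent_spacelike(1))
    show "\<gamma> t \<in> hyperboloid"
      using img t by (auto simp: path_image_def)
    show "mink (\<gamma> t) (\<gamma>' t) = 0"
      by (rule curve_velocity_tangent[OF deriv img t])
  qed
  then have speed: "0 \<le> sqrt (- mink (vector_derivative \<gamma> (at t)) (vector_derivative \<gamma> (at t)))"
    if "t \<in> {0..1}" for t
    using that by (simp add: vector_derivative_at[OF bspec[OF deriv]])
  show ?thesis
    unfolding hyp_length_def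
    by (cases "(\<lambda>t. sqrt (- mink (vector_derivative \<gamma> (at t)) (vector_derivative \<gamma> (at t))))
        integrable_on {0..1}")
      (auto intro: Henstock_Kurzweil_Integration.integral_nonneg speed
        simp: not_integrable_integral simp del: real_sqrt_ge_0_iff)
qed

definition geodesic :: "real^3 \<Rightarrow> real^3 \<Rightarrow> real \<Rightarrow> real \<Rightarrow> real^3" where
  "geodesic p n d t = cosh (t * d) *\<^sub>R p + sinh (t * d) *\<^sub>R n"

lemma geodesic_has_vector_derivative:
  "(geodesic p n d has_vector_derivative
     (d * sinh (t * d)) *\<^sub>R p + (d * cosh (t * d)) *\<^sub>R n) (at t)"
  unfolding geodesic_def
  by (auto intro!: derivative_eq_intros simp: algebra_simps)

lemma geodesic_C1: "geodesic p n d C1_differentiable_on {0..1}"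
  unfolding C1_differentiable_on_def
  by (intro exI[of _ "\<lambda>t. (d * sinh (t * d)) *\<^sub>R p + (d * cosh (t * d)) *\<^sub>R n"] conjI ballI
      geodesic_has_vector_derivative continuous_intros)

lemma geodesic_in_hyperboloid:
  assumes p: "p \<in> hyperboloid" and pn: "mink p n = 0" and nn: "mink n n = -1"
  shows "geodesic p n d t \<in> hyperboloid"
proof (rule hyperboloid_by_pairing[OF _ p])
  have pp: "mink p p = 1"
    using p by (simp add: hyperboloid_def)
  show "mink (geodesic p n d t) (geodesic p n d t) = 1"
    using hyperbolic_pythagoras[of "t * d"]
    by (simp add: geodesic_def mink_expand pp pn nn mink_commute[of n p] power2_eq_square)
  show "mink (geodesic p n d t) p > 0"
    by (simp add: geodesic_def mink_expand pp pn mink_commute[of n p])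
qed

lemma hyp_length_geodesic:
  assumes p: "p \<in> hyperboloid" and pn: "mink p n = 0" and nn: "mink n n = -1" and "d \<ge> 0"
  shows "hyp_length (geodesic p n d) = d"
proof -
  have pp: "mink p p = 1"
    using p by (simp add: hyperboloid_def)
  have "- mink (vector_derivative (geodesic p n d) (at t)) (vector_derivative (geodesic p n d) (at t))
      = d\<^sup>2 * ((cosh (t * d))\<^sup>2 - (sinh (t * d))\<^sup>2)" for t
    unfolding vector_derivative_at[OF geodesic_has_vector_derivative]
    by (simp add: mink_expand pp pn nn mink_commute[of n p] power2_eq_square algebra_simps)
  then have "- mink (vector_derivative (geodesic p n d) (at t))
      (vector_derivative (geodesic p n d) (at t)) = d\<^sup>2" for t
    by (simp add: hyperbolic_pythagoras)
  then show ?thesis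
    using \<open>d \<ge> 0\<close> unfolding hyp_length_def by simp
qed

theorem cosh_hyp_dist:
  assumes p: "p \<in> hyperboloid" and q: "q \<in> hyperboloid"
  shows "cosh (hyp_dist p q) = mink p q"
proof (cases "p = q")
  case True
  \<comment> \<open>No direction towards \<open>q\<close> exists; the constant curve has the least possible length.\<close>
  have const: "(\<lambda>_::real. p) C1_differentiable_on {0..1}" "hyp_length (\<lambda>_. p) = 0"
    by (simp_all add: hyp_length_def mink.zero_left)
  have "hyp_dist p p = 0"
    unfolding hyp_dist_def
  proof (rule cInf_eq_minimum)
    show "0 \<in> {hyp_length \<gamma> |\<gamma>. \<gamma> C1_differentiable_on {0..1} \<and> path_image \<gamma> \<subseteq> hyperboloid \<and>
        pathstart \<gamma> = p \<and> pathfinish \<gamma> = p}"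
      using const p
      by (auto intro!: exI[of _ "\<lambda>_. p"] simp: path_image_def pathstart_def pathfinish_def)
  qed (use hyp_length_nonneg in auto)
  with True p show ?thesis
    by (simp add: hyperboloid_def)
next
  case False
  define c where "c = mink p q"
  define s where "s = sqrt (c\<^sup>2 - 1)"
  \<comment> \<open>The unit tangent vector at \<open>p\<close> that points towards \<open>q\<close>.\<close>
  define n where "n = (1 / s) *\<^sub>R (q - c *\<^sub>R p)"
  define d where "d = arsinh s"
  have pp: "mink p p = 1" and qq: "mink q q = 1"
    using p q by (simp_all add: hyperboloid_def)
  have "c > 1"
    using mink_hyperboloid_ge_1[OF p q] False by (force simp: c_def)
  then have "c\<^sup>2 > 1"
    by simp
  then have s: "s\<^sup>2 = c\<^sup>2 - 1" "s > 0"
    by (simp_all add: s_def)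
  have d: "sinh d = s" "cosh d = c" "d \<ge> 0"
    using s \<open>c > 1\<close> by (simp_all add: d_def cosh_arsinh_real less_imp_le)
  have pn: "mink p n = 0"
    by (simp add: n_def mink_expand pp c_def)
  have nq: "- mink n q = s"
    using s by (simp add: n_def mink_expand qq flip: c_def)
      (simp add: field_simps power2_eq_square)
  have nn: "mink n n = -1"
  proof -
    have "mink n n = (1 / s) * (mink n q - c * mink n p)"
      by (subst (2) n_def) (simp add: mink_expand)
    also have "\<dots> = -1"
      using nq pn s by (simp add: mink_commute field_simps)
    finally show ?thesis .
  qed
  have ends: "pathstart (geodesic p n d) = p" "pathfinish (geodesic p n d) = q"
    using s by (simp_all add: pathstart_def pathfinish_def geodesic_def d n_def)
  have "hyp_dist p q = d"
    unfolding hyp_dist_def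
  proof (rule cInf_eq_minimum)
    show "d \<in> {hyp_length \<gamma> |\<gamma>. \<gamma> C1_differentiable_on {0..1} \<and> path_image \<gamma> \<subseteq> hyperboloid \<and>
        pathstart \<gamma> = p \<and> pathfinish \<gamma> = q}"
      using hyp_length_geodesic[OF p pn nn d(3)] geodesic_C1 ends
        geodesic_in_hyperboloid[OF p pn nn]
      by (auto intro!: exI[of _ "geodesic p n d"] simp: path_image_def)
    fix l
    assume "l \<in> {hyp_length \<gamma> |\<gamma>. \<gamma> C1_differentiable_on {0..1} \<and> path_image \<gamma> \<subseteq> hyperboloid \<and>
        pathstart \<gamma> = p \<and> pathfinish \<gamma> = q}"
    then obtain \<gamma> where "l = hyp_length \<gamma>" "\<gamma> C1_differentiable_on {0..1}"
      "path_image \<gamma> \<subseteq> hyperboloid" "pathstart \<gamma> = p" "pathfinish \<gamma> = q"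
      by auto
    then show "d \<le> l"
      using hyp_length_lower_bound[of \<gamma> n] nn nq pn by (simp add: d_def mink_commute[of n p])
  qed
  then show ?thesis
    by (simp add: d c_def)
qed

section \<open>The center of mass as minimizer\<close>

lemma mink_sum_pos:
  assumes "finite J" "J \<noteq> {}" "\<And>j. j \<in> J \<Longrightarrow> x j \<in> hyperboloid" "p \<in> hyperboloid"
  shows "mink p (\<Sum>j\<in>J. x j) > 0"
  unfolding mink.sum_right using assms by (intro sum_pos mink_hyperboloid_pos) auto

lemma mink_sum_sum_pos:
  assumes "finite J" "J \<noteq> {}" "\<And>j. j \<in> J \<Longrightarrow> x j \<in> hyperboloid"
  shows "mink (\<Sum>j\<in>J. x j) (\<Sum>j\<in>J. x j) > 0"
  using assms mink_sum_pos[OF assms]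
  by (subst mink.sum_left) (intro sum_pos, auto)

lemma center_of_mass_in_hyperboloid:
  assumes "r \<ge> 1" and x: "\<And>j. j \<in> {1..r} \<Longrightarrow> x j \<in> hyperboloid"
  shows "center_of_mass r x \<in> hyperboloid"
proof (rule hyperboloid_by_pairing)
  let ?S = "\<Sum>j=1..r. x j"
  have ne: "finite {1..r}" "{1..r} \<noteq> {}"
    using \<open>r \<ge> 1\<close> by auto
  have SS: "mink ?S ?S > 0"
    by (rule mink_sum_sum_pos[OF ne x])
  then show "mink (center_of_mass r x) (center_of_mass r x) = 1"
    by (simp add: center_of_mass_def mink_norm_def mink_expand field_simps)
  show x1: "x 1 \<in> hyperboloid"
    using \<open>r \<ge> 1\<close> by (intro x) auto
  show "mink (center_of_mass r x) (x 1) > 0"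
    using SS mink_sum_pos[OF ne x x1]
    by (simp add: center_of_mass_def mink_norm_def mink_expand mink_commute)
qed

lemma sum_cosh_hyp_dist:
  assumes "r \<ge> 1" and x: "\<And>j. j \<in> {1..r} \<Longrightarrow> x j \<in> hyperboloid" and p: "p \<in> hyperboloid"
  shows "(\<Sum>j=1..r. cosh (hyp_dist p (x j)))
    = mink_norm (\<Sum>j=1..r. x j) * mink p (center_of_mass r x)"
proof -
  have "mink (\<Sum>j=1..r. x j) (\<Sum>j=1..r. x j) > 0"
    using \<open>r \<ge> 1\<close> by (intro mink_sum_sum_pos x) auto
  moreover have "(\<Sum>j=1..r. cosh (hyp_dist p (x j))) = mink p (\<Sum>j=1..r. x j)"
    unfolding mink.sum_right by (intro sum.cong) (auto intro!: cosh_hyp_dist p x)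
  ultimately show ?thesis
    by (simp add: center_of_mass_def mink_norm_def mink_expand)
qed

lemma center_of_mass_unique_minimizer:
  assumes "r \<ge> 1" and x: "\<And>j. j \<in> {1..r} \<Longrightarrow> x j \<in> hyperboloid"
  shows "{p \<in> hyperboloid. \<forall>q\<in>hyperboloid.
            (\<Sum>j=1..r. cosh (hyp_dist p (x j))) \<le> (\<Sum>j=1..r. cosh (hyp_dist q (x j)))}
         = {center_of_mass r x}" (is "?minimizers = _")
proof -
  let ?c = "center_of_mass r x"
  have c: "?c \<in> hyperboloid"
    by (rule center_of_mass_in_hyperboloid[OF assms])
  have "mink_norm (\<Sum>j=1..r. x j) > 0"
    unfolding mink_norm_def real_sqrt_gt_0_iff
    using \<open>r \<ge> 1\<close> by (intro mink_sum_sum_pos x) auto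
  then have "?minimizers = {p \<in> hyperboloid. \<forall>q\<in>hyperboloid. mink p ?c \<le> mink q ?c}"
    using sum_cosh_hyp_dist[OF assms] by auto
  also have "\<dots> = {?c}"
  proof -
    have cc: "mink ?c ?c = 1"
      using c by (simp add: hyperboloid_def)
    have "p = ?c" if "p \<in> hyperboloid" "mink p ?c \<le> mink ?c ?c" for p
      using mink_hyperboloid_ge_1[OF that(1) c] that(2) cc by simp
    then show ?thesis
      using c cc mink_hyperboloid_ge_1(1)[OF _ c] by auto
  qed
  finally show ?thesis .
qed

section \<open>The action of the special linear group\<close>

text \<open>The congruence action \<open>X \<mapsto> B X B\<^sup>T\<close> on the symmetric matrices with rows
  \<open>(p\<^sub>3 - p\<^sub>1, p\<^sub>2)\<close> and \<open>(p\<^sub>2, p\<^sub>3 + p\<^sub>1)\<close>; here \<open>P\<close>, \<open>R\<close> and \<open>Q\<close> are the entries of the transformed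
  matrix.\<close>

definition congruence_act :: "real^2^2 \<Rightarrow> real^3 \<Rightarrow> real^3" where
  "congruence_act B p =
     (let a = B$1$1; b = B$1$2; c = B$2$1; d = B$2$2;
          P = a\<^sup>2 * (p$3 - p$1) + 2 * a * b * p$2 + b\<^sup>2 * (p$3 + p$1);
          R = a * c * (p$3 - p$1) + (a * d + b * c) * p$2 + b * d * (p$3 + p$1);
          Q = c\<^sup>2 * (p$3 - p$1) + 2 * c * d * p$2 + d\<^sup>2 * (p$3 + p$1)
      in vector [(Q - P) / 2, R, (Q + P) / 2])"

lemma linear_congruence_act: "linear (congruence_act B)"
  by (rule linearI)
    (simp_all add: congruence_act_def Let_def vec_eq_iff forall_3 vector_3 field_simps)

lemma mink_congruence_act: "mink (congruence_act B p) (congruence_act B p) = (det B)\<^sup>2 * mink p p"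
  by (simp add: congruence_act_def Let_def vector_3 mink_def det_2 power2_eq_square field_simps)

text \<open>The symmetric matrix of a point of the hyperboloid has determinant \<open>1\<close> and positive trace, hence
  it is positive definite, and this is its lower right entry.\<close>

lemma hyperboloid_plus_pos:
  assumes "p \<in> hyperboloid"
  shows "p$3 + p$1 > 0"
proof -
  have "(p$3)\<^sup>2 = 1 + (p$1)\<^sup>2 + (p$2)\<^sup>2" "p$3 > 0"
    using assms by (auto simp: hyperboloid_def mink_def power2_eq_square)
  then have "\<bar>p$1\<bar> < p$3"
    by (intro power2_less_imp_less[of "\<bar>p$1\<bar>"]) (auto simp: add_pos_nonneg)
  then show ?thesis by linarith
qed

definition of_hyperboloid :: "real^3 \<Rightarrow> complex" where
  "of_hyperboloid p = Complex (p$2 / (p$3 + p$1)) (1 / (p$3 + p$1))"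

lemma of_to_hyperboloid:
  assumes "z \<in> upper_half_plane"
  shows "of_hyperboloid (to_hyperboloid z) = z"
proof -
  have v: "Im z > 0"
    using assms by (simp add: upper_half_plane_def)
  have "to_hyperboloid z $ 3 + to_hyperboloid z $ 1 = 1 / Im z" "to_hyperboloid z $ 2 = Re z / Im z"
    using v by (simp_all add: to_hyperboloid_def Let_def vector_3 field_simps)
  then show ?thesis
    using v by (simp add: of_hyperboloid_def complex_eq_iff)
qed

lemma to_of_hyperboloid:
  assumes "p \<in> hyperboloid"
  shows "to_hyperboloid (of_hyperboloid p) = p"
proof -
  define k where "k = p$3 + p$1"
  have k: "k > 0"
    using hyperboloid_plus_pos[OF assms] by (simp add: k_def)
  have "k * (p$3 - p$1) = 1 + (p$2)\<^sup>2"
    using assms by (simp add: k_def hyperboloid_def mink_def power2_eq_square algebra_simps)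
  then have eqs: "(k\<^sup>2 - (p$2)\<^sup>2 - 1) = 2 * k * p$1" "(k\<^sup>2 + (p$2)\<^sup>2 + 1) = 2 * k * p$3"
    by (simp_all add: k_def power2_eq_square algebra_simps)
  have "(1 - (p$2 / k)\<^sup>2 - (1 / k)\<^sup>2) / (2 * (1 / k)) = (k\<^sup>2 - (p$2)\<^sup>2 - 1) / (2 * k)"
    "(1 + (p$2 / k)\<^sup>2 + (1 / k)\<^sup>2) / (2 * (1 / k)) = (k\<^sup>2 + (p$2)\<^sup>2 + 1) / (2 * k)"
    using k by (simp_all add: field_simps power2_eq_square)
  then show ?thesis
    using k eqs
    by (simp add: to_hyperboloid_def of_hyperboloid_def Let_def vec_eq_iff forall_3 vector_3
        flip: k_def)
qed

lemma of_hyperboloid_in_upper_half_plane: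
  "p \<in> hyperboloid \<Longrightarrow> of_hyperboloid p \<in> upper_half_plane"
  using hyperboloid_plus_pos by (simp add: upper_half_plane_def of_hyperboloid_def)

lemma inv_into_to_hyperboloid:
  assumes "p \<in> hyperboloid"
  shows "inv_into upper_half_plane to_hyperboloid p = of_hyperboloid p"
  using assms
  by (intro inv_into_f_eq inj_on_inverseI[of _ of_hyperboloid] of_to_hyperboloid
      of_hyperboloid_in_upper_half_plane to_of_hyperboloid)

lemma det_matrix_inv_eq_1:
  fixes A :: "real^'n^'n"
  assumes "det A = 1"
  shows "det (matrix_inv A) = 1"
proof -
  have "invertible A"
    using assms by (simp add: invertible_det_nz)
  then have "A ** matrix_inv A = mat 1"
    unfolding invertible_def matrix_inv_def by (metis (mono_tags, lifting) someI_ex)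
  from arg_cong[OF this, of det] show ?thesis
    by (simp add: det_mul assms)
qed

text \<open>With \<open>N = \<bar>c z + d\<bar>\<^sup>2\<close> the image \<open>w\<close> of \<open>z\<close> has \<open>Im w = Im z / N\<close>,
  \<open>\<bar>w\<bar>\<^sup>2 = \<bar>a z + b\<bar>\<^sup>2 / N\<close> and \<open>Re w = Re ((a z + b) * cnj (c z + d)) / N\<close>. Dividing by
  \<open>Im w\<close> cancels \<open>N\<close>, and the three entries of the matrix of \<open>w\<close> are quadratic
  in \<open>B\<close>.\<close>

lemma to_hyperboloid_moebius:
  assumes z: "z \<in> upper_half_plane" and B: "det B = 1"
  shows "to_hyperboloid (moebius (complex_of_real (B$1$1)) (complex_of_real (B$1$2))
            (complex_of_real (B$2$1)) (complex_of_real (B$2$2)) z)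
    = congruence_act B (to_hyperboloid z)"
proof -
  define a b c d where abcd: "a = B$1$1" "b = B$1$2" "c = B$2$1" "d = B$2$2"
  define u v where uv: "u = Re z" "v = Im z"
  define N where "N = (c * u + d)\<^sup>2 + (c * v)\<^sup>2"
  define w where "w = moebius (complex_of_real a) (complex_of_real b)
            (complex_of_real c) (complex_of_real d) z"
  have v: "v > 0"
    using z by (simp add: upper_half_plane_def uv)
  have det: "a * d - b * c = 1"
    using B by (simp add: det_2 abcd)
  have N: "N > 0"
  proof (cases "c = 0")
    case True
    with det have "d \<noteq> 0" by auto
    with True show ?thesis by (simp add: N_def)
  next
    case False
    with v show ?thesis by (simp add: N_def add_nonneg_pos)
  qed
  have Re_w: "Re w = ((a * u + b) * (c * u + d) + a * c * v\<^sup>2) / N"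
    by (simp add: w_def moebius_def Re_divide N_def uv power2_eq_square algebra_simps)
  have Im_w: "Im w = v / N"
  proof -
    have "Im w = (a * d - b * c) * v / N"
      by (simp add: w_def moebius_def Im_divide N_def uv power2_eq_square algebra_simps)
    then show ?thesis by (simp add: det)
  qed
  have norm_w: "(Re w)\<^sup>2 + (Im w)\<^sup>2 = ((a * u + b)\<^sup>2 + (a * v)\<^sup>2) / N"
    unfolding cmod_power2[symmetric]
    by (simp add: w_def moebius_def norm_divide power_divide cmod_power2 N_def uv)
  have coords: "to_hyperboloid w = vector [(N - ((a * u + b)\<^sup>2 + (a * v)\<^sup>2)) / (2 * v),
      ((a * u + b) * (c * u + d) + a * c * v\<^sup>2) / v, (N + ((a * u + b)\<^sup>2 + (a * v)\<^sup>2)) / (2 * v)]"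
  proof -
    have "(1 - (Re w)\<^sup>2 - (Im w)\<^sup>2) / (2 * Im w) = (N - ((a * u + b)\<^sup>2 + (a * v)\<^sup>2)) / (2 * v)"
      using norm_w N v unfolding diff_diff_eq by (simp add: Im_w field_simps)
    moreover have "(1 + (Re w)\<^sup>2 + (Im w)\<^sup>2) / (2 * Im w)
        = (N + ((a * u + b)\<^sup>2 + (a * v)\<^sup>2)) / (2 * v)"
      using norm_w N v unfolding add.assoc by (simp add: Im_w field_simps)
    moreover have "Re w / Im w = ((a * u + b) * (c * u + d) + a * c * v\<^sup>2) / v"
      using N v by (simp add: Re_w Im_w)
    ultimately show ?thesis
      by (simp add: to_hyperboloid_def Let_def)
  qed
  have "to_hyperboloid w = congruence_act B (to_hyperboloid z)"
    unfolding coords using v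
    by (simp add: congruence_act_def to_hyperboloid_def Let_def vec_eq_iff forall_3 vector_3
        flip: abcd uv)
      (simp add: N_def field_simps power2_eq_square)
  then show ?thesis
    by (simp add: w_def abcd)
qed

lemma hyp_act_eq_congruence_act:
  assumes "A \<in> SL2R" "p \<in> hyperboloid"
  shows "hyp_act p A = congruence_act (matrix_inv A) p"
  using assms
  by (simp add: hyp_act_def uhp_act_def Let_def inv_into_to_hyperboloid to_hyperboloid_moebius
      of_hyperboloid_in_upper_half_plane to_of_hyperboloid det_matrix_inv_eq_1 SL2R_def)

text \<open>A linear map that preserves the Minkowski form commutes both with the sum and with the
  normalization.\<close>

lemma center_of_mass_hyp_act:
  assumes "r \<ge> 1" and x: "\<And>j. j \<in> {1..r} \<Longrightarrow> x j \<in> hyperboloid" and A: "A \<in> SL2R"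
  shows "center_of_mass r (\<lambda>j. hyp_act (x j) A) = hyp_act (center_of_mass r x) A"
proof -
  let ?L = "congruence_act (matrix_inv A)" and ?S = "\<Sum>j=1..r. x j"
  have lin: "linear ?L"
    by (rule linear_congruence_act)
  have "det (matrix_inv A) = 1"
    using A by (intro det_matrix_inv_eq_1) (simp add: SL2R_def)
  then have norm: "mink_norm (?L ?S) = mink_norm ?S"
    by (simp add: mink_norm_def mink_congruence_act)
  have sum: "(\<Sum>j=1..r. hyp_act (x j) A) = ?L ?S"
    unfolding linear_sum[OF lin]
    by (intro sum.cong) (auto intro!: hyp_act_eq_congruence_act A x)
  have "center_of_mass r (\<lambda>j. hyp_act (x j) A) = ?L (center_of_mass r x)"
    unfolding center_of_mass_def sum norm linear_cmul[OF lin] ..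
  also have "\<dots> = hyp_act (center_of_mass r x) A"
    using hyp_act_eq_congruence_act[OF A center_of_mass_in_hyperboloid[OF assms(1) x]] by simp
  finally show ?thesis .
qed

theorem proposition9:
  fixes r :: nat and x :: "nat \<Rightarrow> real^3"
  assumes "r \<ge> 1"
    and "\<And>j. j \<in> {1..r} \<Longrightarrow> x j \<in> hyperboloid"
  shows "(\<forall>A\<in>SL2R. center_of_mass r (\<lambda>j. hyp_act (x j) A) = hyp_act (center_of_mass r x) A) \<and>
         {p \<in> hyperboloid. \<forall>q\<in>hyperboloid.
            (\<Sum>j=1..r. cosh (hyp_dist p (x j))) \<le> (\<Sum>j=1..r. cosh (hyp_dist q (x j)))}
         = {center_of_mass r x}"
  by (intro conjI ballI center_of_mass_hyp_act center_of_mass_unique_minimizer assms)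

end
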